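(* Let $p$ be a prime and $q\in\mathbb{C}_p$ with $|1-q|_p<1$. For every $n\in\mathbb{N}$ with $n>1$, $$\int_{\mathbb{Z}_p}[1-x]_{\frac{1}{q}}^n\,d\mu_q(x)=q^2\int_{\mathbb{Z}_p}[x]_{\frac{1}{q}}^n\,d\mu_{\frac{1}{q}}(x)+n+1-q.$$
   Context: For $y\in\mathbb{Z}_p$, $[y]_q=\frac{1-q^y}{1-q}$, and $[y]_{1/q}$ is the same with $q$ replaced by $q^{-1}$. For a uniformly differentiable $f:\mathbb{Z}_p\to\mathbb{C}_p$, the $p$-adic $q$-integral is $\int_{\mathbb{Z}_p}f(x)\,d\mu_q(x)=\lim_{N\to\infty}\frac{1}{[p^N]_q}\sum_{x=0}^{p^N-1}f(x)q^x$; $d\mu_{1/q}$ denotes the same construction with $q$ replaced by $q^{-1}$.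
   Formalization: The formal theorem assumes that [p^N]_q is nonzero for all N, i.e. that q is not a nontrivial root of unity of p-power order; for such q, |1-q|_p<1 holds but the integrals are undefined, since their defining sums divide by zero. *)

theory Defs
  imports "HOL-Analysis.Analysis" "HOL-Computational_Algebra.Computational_Algebra"
begin

text \<open>
  \<open>\<rat>\<close> is the copy of the rationals inside the ambient field. In a complete field of
  characteristic 0 whose absolute value extends the \<open>p\<close>-adic one, its closure is the field of
  \<open>p\<close>-adic numbers.
\<close>

definition Qp :: "'a::{field_char_0, metric_space} set" where
  "Qp = closure \<rat>"

definition Qp_bar :: "'a::{field_char_0, metric_space} set" where
  "Qp_bar = {x. \<exists>P. P \<noteq> 0 \<and> (\<forall>i. coeff P i \<in> Qp) \<and> poly P x = 0}"

text \<open>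
  The field \<open>\<complex>\<^sub>p\<close>, determined by these conditions up to isometric isomorphism: a
  complete, algebraically closed field with a non-Archimedean absolute value, normalised by
  \<open>\<bar>p\<bar> = 1/p\<close>, in which the algebraic closure of \<open>\<rat>\<^sub>p\<close> is dense.
  The topology, limits and completeness of the type are those of its metric, which is tied to the
  absolute value by \<open>dist_absp\<close>. Definiteness of the absolute value follows from that of the metric.
\<close>

locale padic_complex_field =
  fixes p :: nat
    and absp :: "'a::{alg_closed_field, field_char_0, complete_space} \<Rightarrow> real"
  assumes prime_p: "prime p"
    and dist_absp: "dist x y = absp (x - y)"
    and absp_mult: "absp (x * y) = absp x * absp y"
    and absp_ultrametric: "absp (x + y) \<le> max (absp x) (absp y)"
    and absp_p: "absp (of_nat p) = 1 / real p"
    and closure_Qp_bar: "closure (Qp_bar :: 'a set) = UNIV"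

text \<open>
  \<open>q\<^sup>y\<close> for a \<open>p\<close>-adic integer \<open>y\<close> and \<open>\<bar>1 - q\<bar> < 1\<close>: the
  value at \<open>y\<close> of the continuous extension of \<open>k \<mapsto> q\<^sup>k\<close> from the natural
  numbers to \<open>\<int>\<^sub>p\<close>, that is, the limit of \<open>q\<^sup>k\<close> as the natural number
  \<open>k\<close> tends to \<open>y\<close> \<open>p\<close>-adically.
\<close>

definition padic_power :: "'a::{field, metric_space} \<Rightarrow> 'a \<Rightarrow> 'a" where
  "padic_power q y = Lim (filtercomap of_nat (nhds y)) (\<lambda>k::nat. q ^ k)"

text \<open>
  At \<open>q = 1\<close> the quotient is read as its limit \<open>y\<close> for \<open>q \<rightarrow> 1\<close>.
\<close>

definition q_bracket :: "'a::{field, metric_space} \<Rightarrow> 'a \<Rightarrow> 'a" where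
  "q_bracket q y = (if q = 1 then y else (1 - padic_power q y) / (1 - q))"

text \<open>
  The argument \<open>f\<close> stands for a function on \<open>\<int>\<^sub>p\<close>; the integral only
  uses its values at natural numbers. If \<open>q \<noteq> 1\<close> is a root of unity of
  \<open>p\<close>-power order, then \<open>[p\<^sup>N]\<^sub>q = 0\<close> for all large \<open>N\<close> and the
  integral is meaningless; uses of it need \<open>[p\<^sup>N]\<^sub>q \<noteq> 0\<close> as a hypothesis.
\<close>

definition q_integral_sum ::
  "nat \<Rightarrow> 'a::{field, metric_space} \<Rightarrow> ('a \<Rightarrow> 'a) \<Rightarrow> nat \<Rightarrow> 'a" where
  "q_integral_sum p q f N =
     1 / q_bracket q (of_nat (p ^ N)) * (\<Sum>x = 0..p ^ N - 1. f (of_nat x) * q ^ x)"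

definition q_integrable ::
  "nat \<Rightarrow> 'a::{field, metric_space} \<Rightarrow> ('a \<Rightarrow> 'a) \<Rightarrow> bool" where
  "q_integrable p q f \<longleftrightarrow> convergent (q_integral_sum p q f)"

definition q_integral ::
  "nat \<Rightarrow> 'a::{field, metric_space} \<Rightarrow> ('a \<Rightarrow> 'a) \<Rightarrow> 'a" where
  "q_integral p q f = lim (q_integral_sum p q f)"

end

theory Submission
  imports Defs
begin

text \<open>
  For \<open>q \<noteq> 1\<close>, with \<open>Q = q\<^bsup>p\<^sup>N\<^esup>\<close>, the geometric sum gives
  \<open>1/[p\<^sup>N]\<^sub>q \<Sum>\<^sub>x q\<^bsup>lx\<^esup> q\<^sup>x = (1 - q)/(1 - q\<^bsup>l+1\<^esup>) (1 + Q + \<dots> + Q\<^sup>l)\<close>,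
  and \<open>Q\<close> tends to 1. Both integrands are polynomials in \<open>q\<^bsup>x\<^esup>\<close>
  (respectively \<open>q\<^bsup>-x\<^esup>\<close>), so both integrals become explicit binomial sums, whose
  difference is evaluated by the binomial theorem and its derivative.
  For \<open>q = 1\<close>, if \<open>F\<close> is a polynomial with \<open>F(y + 1) - F(y) = y\<^sup>n\<close>, then
  the integrals of \<open>x\<^sup>n\<close> and of \<open>(1 - x)\<^sup>n\<close> are \<open>F'(0)\<close> and
  \<open>F'(2)\<close>, and these differ by \<open>n 0\<^bsup>n-1\<^esup> + n 1\<^bsup>n-1\<^esup> = n\<close>.
\<close>

context padic_complex_field
begin

section \<open>Elementary properties of the absolute value\<close>

lemma absp_nonneg: "absp x \<ge> 0"
  using dist_absp[of x 0] zero_le_dist[of x 0] by simp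

lemma absp_eq_0_iff: "absp x = 0 \<longleftrightarrow> x = 0"
  using dist_absp[of x 0] dist_eq_0_iff[of x 0] by simp

lemma absp_0: "absp 0 = 0"
  by (simp add: absp_eq_0_iff)

lemma absp_1: "absp 1 = 1"
  using absp_mult[of 1 1] absp_eq_0_iff[of 1] by simp

lemma absp_minus_commute: "absp (x - y) = absp (y - x)"
  using dist_absp[of x y] dist_absp[of y x] by (simp add: dist_commute)

lemma absp_minus: "absp (- x) = absp x"
  using absp_minus_commute[of 0 x] by simp

lemma absp_power: "absp (x ^ k) = absp x ^ k"
  by (induction k) (simp_all add: absp_1 absp_mult)

lemma absp_add_le: "absp x \<le> B \<Longrightarrow> absp y \<le> B \<Longrightarrow> absp (x + y) \<le> B"
  using absp_ultrametric[of x y] by simp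

lemma absp_sum_le:
  assumes "\<And>i. i \<in> A \<Longrightarrow> absp (f i) \<le> B" and "0 \<le> B"
  shows "absp (sum f A) \<le> B"
  using assms by (induction A rule: infinite_finite_induct) (auto simp: absp_0 intro: absp_add_le)

lemma absp_of_nat_le_1: "absp (of_nat k) \<le> 1"
  by (induction k) (auto simp: absp_0 absp_1 intro: absp_add_le)

lemma absp_of_int_le_1: "absp (of_int k) \<le> 1"
  by (cases k) (use absp_of_nat_le_1 absp_minus in \<open>auto simp del: of_nat_Suc\<close>)

lemma p_gt_1: "p > 1"
  using prime_p prime_gt_1_nat by simp

section \<open>Divisibility of integers read off from the absolute value\<close>

text \<open>Otherwise Bezout writes 1 as \<open>a * p + b * m\<close>, a sum of two elements of
  absolute value below 1, against the ultrametric inequality.\<close>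

lemma dvd_if_absp_of_int_less_1:
  assumes "absp (of_int m) < 1"
  shows "int p dvd m"
proof (rule ccontr)
  assume "\<not> int p dvd m"
  then have "coprime (int p) m"
    using prime_p by (simp add: prime_imp_coprime)
  then obtain a b where ab: "a * int p + b * m = 1"
    by (metis bezout_int coprime_imp_gcd_eq_1)
  have "absp (of_int (a * int p)) < 1"
  proof -
    have "absp (of_int a) * (1 / real p) \<le> 1 * (1 / real p)"
      by (intro mult_right_mono absp_of_int_le_1) simp
    also have "\<dots> < 1" using p_gt_1 by simp
    finally show ?thesis by (simp add: absp_mult absp_p)
  qed
  moreover have "absp (of_int (b * m)) < 1"
    using mult_right_mono[OF absp_of_int_le_1[of b] absp_nonneg[of "of_int m"]] assms
    by (simp add: absp_mult)
  ultimately have "absp (of_int (a * int p) + of_int (b * m)) < 1"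
    using absp_ultrametric[of "of_int (a * int p)" "of_int (b * m)"] by linarith
  then show False
    using ab absp_1 by (simp flip: of_int_add of_int_mult)
qed

text \<open>Turns p-adic closeness into a congruence. The exponent is \<open>Suc N\<close> because
  the bound is strict and nonzero integers have absolute value a power of 1/p.\<close>

lemma power_dvd_if_absp_of_int_less:
  assumes "absp (of_int m) < (1 / real p) ^ N"
  shows "int p ^ Suc N dvd m"
  using assms
proof (induction N arbitrary: m)
  case 0
  then show ?case by (simp add: dvd_if_absp_of_int_less_1)
next
  case (Suc N)
  have "(1 / real p) ^ Suc N \<le> 1"
    by (rule power_le_one) (use p_gt_1 in auto)
  with Suc.prems obtain k where k: "m = int p * k"
    using dvd_if_absp_of_int_less_1[of m] by auto
  have "absp (of_int k) < (1 / real p) ^ N"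
    using Suc.prems p_gt_1 by (simp add: k absp_mult absp_p field_simps)
  from Suc.IH[OF this] show ?case by (simp add: k)
qed

section \<open>Limits and continuity of polynomials\<close>

lemma tendsto_absp_iff: "(X \<longlongrightarrow> L) F \<longleftrightarrow> ((\<lambda>i. absp (X i - L)) \<longlongrightarrow> 0) F"
  using tendsto_dist_iff[of X L F] by (simp add: dist_absp)

text \<open>The sort of \<open>'a\<close> does not tie the metric to the ring operations, so
  continuity comes from \<open>absp\<close>. The Horner step splits the difference as
  \<open>(x - L) * poly P x + L * (poly P x - poly P L)\<close> and bounds \<open>poly P x\<close>
  through \<open>poly P L\<close>.\<close>

lemma padic_tendsto_poly:
  fixes X :: "'i \<Rightarrow> 'a"
  assumes "(X \<longlongrightarrow> L) F"
  shows "((\<lambda>i. poly P (X i)) \<longlongrightarrow> poly P L) F"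
proof -
  have 0: "((\<lambda>i. absp (X i - L)) \<longlongrightarrow> 0) F"
    using assms by (simp add: tendsto_absp_iff)
  have "((\<lambda>i. absp (poly P (X i) - poly P L)) \<longlongrightarrow> 0) F"
  proof (induction P)
    case 0
    then show ?case by (simp add: absp_0)
  next
    case (pCons a P)
    let ?d = "\<lambda>i. absp (poly P (X i) - poly P L)"
    have "((\<lambda>i. absp (X i - L) * (?d i + absp (poly P L)) + absp L * ?d i)
             \<longlongrightarrow> 0 * (0 + absp (poly P L)) + absp L * 0) F"
      by (intro tendsto_intros 0 pCons.IH)
    then have lim: "((\<lambda>i. absp (X i - L) * (?d i + absp (poly P L)) + absp L * ?d i) \<longlongrightarrow> 0) F"
      by simp
    show ?case
    proof (rule tendsto_sandwich[OF _ _ tendsto_const lim])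
      show "\<forall>\<^sub>F i in F. 0 \<le> absp (poly (pCons a P) (X i) - poly (pCons a P) L)"
        by (simp add: absp_nonneg)
      have "absp (poly (pCons a P) x - poly (pCons a P) L)
          \<le> absp (x - L) * (absp (poly P x - poly P L) + absp (poly P L))
            + absp L * absp (poly P x - poly P L)" for x
      proof -
        have triangle: "absp (u + v) \<le> absp u + absp v" for u v
          using absp_ultrametric[of u v] absp_nonneg[of u] absp_nonneg[of v] by linarith
        have "absp (poly P x) \<le> absp (poly P x - poly P L) + absp (poly P L)"
          using triangle[of "poly P x - poly P L" "poly P L"] by simp
        then have "absp ((x - L) * poly P x)
            \<le> absp (x - L) * (absp (poly P x - poly P L) + absp (poly P L))"
          by (simp add: absp_mult absp_nonneg mult_left_mono)
        moreover have "poly (pCons a P) x - poly (pCons a P) L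
            = (x - L) * poly P x + L * (poly P x - poly P L)"
          by (simp add: algebra_simps)
        ultimately show ?thesis
          using triangle[of "(x - L) * poly P x" "L * (poly P x - poly P L)"]
          by (simp add: absp_mult)
      qed
      then show "\<forall>\<^sub>F i in F. absp (poly (pCons a P) (X i) - poly (pCons a P) L)
          \<le> absp (X i - L) * (?d i + absp (poly P L)) + absp L * ?d i"
        by simp
    qed
  qed
  then show ?thesis by (simp add: tendsto_absp_iff)
qed

lemma p_power_tendsto_0: "(\<lambda>N. of_nat (p ^ N)) \<longlonglongrightarrow> (0 :: 'a)"
proof -
  have "(\<lambda>N. (1 / real p) ^ N) \<longlonglongrightarrow> 0"
    by (rule LIMSEQ_power_zero) (use p_gt_1 in auto)
  then show ?thesis
    by (simp add: tendsto_absp_iff absp_power absp_p)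
qed

section \<open>Powers of q in the open unit disc around 1\<close>

lemma absp_eq_1_if_near_1:
  assumes "absp (1 - q) < 1"
  shows "absp q = 1"
  using absp_ultrametric[of "1 - q" q] absp_ultrametric[of 1 "q - 1"] assms
    absp_minus_commute[of q 1] absp_1
  by auto

lemma absp_power_minus_1_le:
  assumes "absp q = 1"
  shows "absp (q ^ k - 1) \<le> absp (q - 1)"
proof -
  have "absp (\<Sum>i<k. q ^ i) \<le> 1"
    by (rule absp_sum_le) (simp_all add: absp_power assms)
  then show ?thesis
    using mult_left_mono[OF _ absp_nonneg[of "q - 1"], of "absp (\<Sum>i<k. q ^ i)" 1]
    by (simp add: power_diff_1_eq absp_mult)
qed

text \<open>Each power of q is congruent to 1 modulo q - 1, so a geometric sum is congruent to its
  number of terms.\<close>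

lemma absp_geometric_sum_le:
  assumes "absp q = 1"
  shows "absp ((\<Sum>i<k. q ^ i) - of_nat k) \<le> absp (q - 1)"
proof -
  have "(\<Sum>i<k. q ^ i) - of_nat k = (\<Sum>i<k. q ^ i - 1)"
    by (simp add: sum_subtractf)
  then show ?thesis
    by (auto intro!: absp_sum_le absp_power_minus_1_le assms simp: absp_nonneg)
qed

text \<open>Raising Q to the p-th power multiplies Q - 1 by 1 + Q + ... + Q^(p-1), which is
  congruent to p modulo Q - 1. Its absolute value is therefore at most the larger of 1/p and |q -
  1|, a fixed constant below 1.\<close>

lemma power_p_power_tendsto_1:
  assumes q: "absp (1 - q) < 1"
  shows "(\<lambda>N. q ^ (p ^ N)) \<longlonglongrightarrow> 1"
proof -
  define c where "c = max (1 / real p) (absp (q - 1))"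
  have c: "0 \<le> c" "c < 1"
    using p_gt_1 q by (auto simp: c_def absp_minus_commute[of q 1] le_max_iff_disj)
  have q1: "absp (q ^ k) = 1" for k
    using absp_eq_1_if_near_1[OF q] by (simp add: absp_power)
  have bound: "absp (q ^ (p ^ N) - 1) \<le> c ^ N" for N
  proof (induction N)
    case 0
    then show ?case using c by (simp add: c_def)
  next
    case (Suc N)
    let ?Q = "q ^ (p ^ N)"
    have "absp (?Q - 1) \<le> c"
      using absp_power_minus_1_le[of q "p ^ N"] q1[of 1] by (simp add: c_def)
    then have "absp (((\<Sum>i<p. ?Q ^ i) - of_nat p) + of_nat p) \<le> c"
      using absp_geometric_sum_le[OF q1, of "p ^ N" p]
      by (intro absp_add_le) (auto simp: absp_p c_def)
    then have "absp (?Q - 1) * absp (\<Sum>i<p. ?Q ^ i) \<le> c ^ N * c"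
      using Suc.IH c by (intro mult_mono) (auto simp: absp_nonneg)
    moreover have "q ^ (p ^ Suc N) - 1 = (?Q - 1) * (\<Sum>i<p. ?Q ^ i)"
      by (simp add: power_mult mult.commute[of p] flip: power_diff_1_eq)
    ultimately show ?case by (simp add: absp_mult mult.commute)
  qed
  have "(\<lambda>N. c ^ N) \<longlonglongrightarrow> 0"
    by (rule LIMSEQ_power_zero) (use c in auto)
  then have "(\<lambda>N. absp (q ^ (p ^ N) - 1)) \<longlonglongrightarrow> 0"
    by (rule tendsto_sandwich[OF _ _ tendsto_const, rotated 2])
      (auto simp: absp_nonneg bound)
  then show ?thesis by (simp add: tendsto_absp_iff)
qed

lemma absp_power_diff_le:
  assumes q: "absp q = 1" and "int d dvd int i - int j"
  shows "absp (q ^ i - q ^ j) \<le> absp (q ^ d - 1)"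
proof -
  have *: "absp (q ^ i - q ^ j) \<le> absp (q ^ d - 1)"
    if le: "j \<le> i" and dvd: "int d dvd int i - int j" for i j
  proof -
    from le dvd have "d dvd i - j"
      by (simp flip: of_nat_diff)
    then obtain k where k: "i - j = d * k" ..
    have "i = j + d * k" using k le by simp
    then have "q ^ i - q ^ j = q ^ j * ((q ^ d) ^ k - 1)"
      by (simp add: power_add power_mult algebra_simps)
    then show ?thesis
      using absp_power_minus_1_le[of "q ^ d" k] by (simp add: absp_mult absp_power q)
  qed
  show ?thesis
  proof (cases "j \<le> i")
    case True
    then show ?thesis using * assms by blast
  next
    case False
    then show ?thesis
      using *[of i j] assms(2) absp_minus_commute[of "q ^ i"] by (simp add: dvd_diff_commute)
  qed
qed

section \<open>Values of \<open>padic_power\<close> and \<open>q_bracket\<close> at integers\<close>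

text \<open>The integer y = b - a is given by two naturals, which covers both k and 1 - k. Besides
  convergence, the filter must be nontrivial for \<open>Lim\<close> to be determined: naturals must
  come arbitrarily close to y.\<close>

lemma padic_power_of_int:
  assumes q: "absp (1 - q) < 1" and y: "y + of_nat a = of_nat b"
  shows "padic_power q y = q ^ b / q ^ a"
proof -
  let ?F = "filtercomap of_nat (nhds y) :: nat filter"
  have q1: "absp q = 1"
    using q by (rule absp_eq_1_if_near_1)
  then have q0: "q \<noteq> 0" using absp_0 by auto
  have near: "\<forall>\<^sub>F k in ?F. absp (of_nat k - y) < e" if "e > 0" for e
  proof (rule eventually_filtercomapI)
    show "\<forall>\<^sub>F z in nhds y. absp (z - y) < e"
      using that by (auto simp: eventually_nhds_metric dist_absp)
  qed
  have diff: "of_nat k - y = of_int (int (k + a) - int b)" for k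
    using y by (simp add: algebra_simps)
  have "(\<lambda>N. absp (q ^ (p ^ N) - 1)) \<longlonglongrightarrow> 0"
    using power_p_power_tendsto_1[OF q] by (simp add: tendsto_absp_iff)
  \<comment> \<open>Closeness below \<open>(1 / real p) ^ N\<close> yields divisibility by
    \<open>p ^ Suc N\<close>, hence the shifted exponent.\<close>
  then have "(\<lambda>N. absp (q ^ (p ^ Suc N) - 1)) \<longlonglongrightarrow> 0"
    by (rule LIMSEQ_Suc)
  then have "\<forall>\<^sub>F k in ?F. absp (q ^ k - q ^ b / q ^ a) < e" if e: "e > 0" for e
  proof -
    obtain N where N: "absp (q ^ (p ^ Suc N) - 1) < e"
      using order_tendstoD(2)[OF \<open>(\<lambda>N. absp (q ^ (p ^ Suc N) - 1)) \<longlonglongrightarrow> 0\<close> e]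
      by (auto simp: eventually_sequentially)
    have "\<forall>\<^sub>F k in ?F. absp (of_nat k - y) < (1 / real p) ^ N"
      by (rule near) (use p_gt_1 in simp)
    then show ?thesis
    proof eventually_elim
      case (elim k)
      then have "int (p ^ Suc N) dvd int (k + a) - int b"
        using power_dvd_if_absp_of_int_less[of "int (k + a) - int b" N]
        unfolding diff by simp
      then have "absp (q ^ (k + a) - q ^ b) < e"
        using absp_power_diff_le[OF q1] N by fastforce
      moreover have "q ^ (k + a) - q ^ b = q ^ a * (q ^ k - q ^ b / q ^ a)"
        using q0 by (simp add: power_add field_simps)
      ultimately show ?case
        by (simp add: absp_mult absp_power q1)
    qed
  qed
  then have lim: "((\<lambda>k. q ^ k) \<longlongrightarrow> q ^ b / q ^ a) ?F"
    by (auto simp: tendsto_iff dist_absp)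
  \<comment> \<open>The natural numbers \<open>b + a p\<^sup>N - a\<close> tend to \<open>y\<close>.\<close>
  have "?F \<noteq> bot"
  proof
    assume "?F = bot"
    then have "eventually (\<lambda>_. False) ?F" by simp
    then obtain P where P: "eventually P (nhds y)" and no: "\<And>k::nat. \<not> P (of_nat k)"
      by (auto simp: eventually_filtercomap)
    have "(\<lambda>N. poly [:y, of_nat a:] (of_nat (p ^ N))) \<longlonglongrightarrow> poly [:y, of_nat a:] 0"
      by (rule padic_tendsto_poly[OF p_power_tendsto_0])
    then have "\<forall>\<^sub>F N in sequentially. P (poly [:y, of_nat a:] (of_nat (p ^ N)))"
      using P unfolding filterlim_iff by auto
    then obtain N where "P (poly [:y, of_nat a:] (of_nat (p ^ N)))"
      by (auto simp: eventually_sequentially)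
    moreover have "poly [:y, of_nat a:] (of_nat (p ^ N)) = of_nat (b + a * p ^ N - a)"
    proof -
      have "a \<le> a * p ^ N" using p_gt_1 by simp
      then have "a \<le> b + a * p ^ N" by (rule trans_le_add2)
      then show ?thesis
        using y by (simp add: of_nat_diff algebra_simps eq_diff_eq)
    qed
    ultimately show False using no by metis
  qed
  with lim show ?thesis
    unfolding padic_power_def by (intro tendsto_Lim) auto
qed

lemma q_bracket_of_nat:
  assumes "absp (1 - q) < 1" and "q \<noteq> 1"
  shows "q_bracket q (of_nat k) = (1 - q ^ k) / (1 - q)"
  using padic_power_of_int[OF assms(1), of "of_nat k" 0 k] assms(2)
  by (simp add: q_bracket_def)

lemma q_bracket_one_minus_of_nat:
  assumes "absp (1 - q) < 1" and "q \<noteq> 1"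
  shows "q_bracket q (1 - of_nat k) = (1 - q / q ^ k) / (1 - q)"
  using padic_power_of_int[OF assms(1), of "1 - of_nat k" k 1] assms(2)
  by (simp add: q_bracket_def)

section \<open>Limits of the integral sums\<close>

text \<open>Roots of unity in this disc have p-power order. With m = p^k m', p not dividing m', and
  Q = q^(p^k) \<noteq> 1, the equation Q^m' = 1 makes the geometric sum of m' terms vanish; as it is
  congruent to m' modulo Q - 1, p would divide m'. This keeps the denominators
  \<open>1 - q ^ Suc l\<close> nonzero.\<close>

lemma power_neq_1:
  assumes q: "absp (1 - q) < 1" and unity: "\<And>N. q ^ (p ^ N) \<noteq> 1" and "m > 0"
  shows "q ^ m \<noteq> 1"
proof
  assume qm: "q ^ m = 1"
  obtain k m' where m: "m = p ^ k * m'" and m': "\<not> p dvd m'"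
    using multiplicity_decompose'[of m p] \<open>m > 0\<close> p_gt_1 by (metis gr0_conv_Suc nat_dvd_1_iff_1 neq0_conv less_irrefl)
  let ?Q = "q ^ (p ^ k)"
  have q1: "absp (q ^ j) = 1" for j
    using absp_eq_1_if_near_1[OF q] by (simp add: absp_power)
  have "(?Q - 1) * (\<Sum>i<m'. ?Q ^ i) = 0"
    using qm by (simp add: m power_mult flip: power_diff_1_eq)
  then have "(\<Sum>i<m'. ?Q ^ i) = 0"
    using unity by simp
  then have "absp (of_nat m') \<le> absp (?Q - 1)"
    using absp_geometric_sum_le[OF q1, of "p ^ k" m'] by (simp add: absp_minus)
  also have "\<dots> < 1"
    using absp_power_minus_1_le[of q "p ^ k"] q1[of 1] q absp_minus_commute[of q 1] by simp
  finally show False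
    using dvd_if_absp_of_int_less_1[of "int m'"] m' by simp
qed

lemma q_integral_sum_tendsto:
  assumes q: "absp (1 - q) < 1" and unity: "\<And>N. q ^ (p ^ N) \<noteq> 1"
    and f: "\<And>x::nat. f (of_nat x) = (\<Sum>l\<le>n. c l * (q ^ x) ^ l)"
  shows "q_integral_sum p q f
    \<longlonglongrightarrow> (\<Sum>l\<le>n. c l * of_nat (Suc l) * ((1 - q) / (1 - q ^ Suc l)))"
proof -
  have q1: "q \<noteq> 1" using unity[of 0] by simp
  \<comment> \<open>Dividing by [p^N]_q turns 1 - Q^(l+1) into 1 + Q + ... + Q^l. So the N-th sum is
    a fixed polynomial in Q = q^(p^N), with no vanishing denominator left, and its limit is the
    value at 1.\<close>
  define P where
    "P = (\<Sum>l\<le>n. smult (c l * ((1 - q) / (1 - q ^ Suc l))) (\<Sum>i<Suc l. monom 1 i))"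
  have P: "poly P z = (\<Sum>l\<le>n. c l * ((1 - q) / (1 - q ^ Suc l)) * (\<Sum>i<Suc l. z ^ i))" for z
    by (simp add: P_def poly_sum poly_monom)
  have "q_integral_sum p q f N = poly P (q ^ (p ^ N))" for N
  proof -
    let ?Q = "q ^ (p ^ N)"
    have Q: "1 - ?Q \<noteq> 0" using unity[of N] by simp
    have geo: "(\<Sum>x<p ^ N. (q ^ Suc l) ^ x)
        = (1 - ?Q) * (\<Sum>i<Suc l. ?Q ^ i) / (1 - q ^ Suc l)" for l
    proof -
      have "(1 - q ^ Suc l) \<noteq> 0"
        using power_neq_1[OF q unity, of "Suc l"] by simp
      moreover have "(1 - q ^ Suc l) * (\<Sum>x<p ^ N. (q ^ Suc l) ^ x) = 1 - (q ^ Suc l) ^ p ^ N"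
        by (rule one_diff_power_eq[symmetric])
      moreover have "(1 - ?Q) * (\<Sum>i<Suc l. ?Q ^ i) = 1 - ?Q ^ Suc l"
        by (rule one_diff_power_eq[symmetric])
      moreover have "(q ^ Suc l) ^ p ^ N = ?Q ^ Suc l"
        by (simp only: mult.commute flip: power_mult)
      ultimately show ?thesis
        by (metis nonzero_mult_div_cancel_left)
    qed
    have "{0..p ^ N - 1} = {..<p ^ N}"
      using p_gt_1 by (auto simp: less_Suc_eq_le[symmetric])
    then have "q_integral_sum p q f N
        = (1 - q) / (1 - ?Q) * (\<Sum>x<p ^ N. (\<Sum>l\<le>n. c l * (q ^ x) ^ l) * q ^ x)"
      by (simp add: q_integral_sum_def q_bracket_of_nat[OF q q1] f del: of_nat_power)
    also have "(\<Sum>x<p ^ N. (\<Sum>l\<le>n. c l * (q ^ x) ^ l) * q ^ x)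
        = (\<Sum>x<p ^ N. \<Sum>l\<le>n. c l * (q ^ Suc l) ^ x)"
      by (simp add: sum_distrib_left sum_distrib_right power_mult_distrib mult_ac flip: power_mult)
    also have "\<dots> = (\<Sum>l\<le>n. c l * (\<Sum>x<p ^ N. (q ^ Suc l) ^ x))"
      by (subst sum.swap) (simp only: sum_distrib_left)
    also have "(1 - q) / (1 - ?Q) * \<dots> = poly P ?Q"
      unfolding geo P sum_distrib_left[of "(1 - q) / (1 - ?Q)"]
      by (rule sum.cong) (use Q in \<open>simp_all add: mult_ac\<close>)
    finally show ?thesis .
  qed
  then have eq: "q_integral_sum p q f = (\<lambda>N. poly P (q ^ (p ^ N)))" ..
  have "poly P 1 = (\<Sum>l\<le>n. c l * of_nat (Suc l) * ((1 - q) / (1 - q ^ Suc l)))"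
    unfolding P by (rule sum.cong) simp_all
  then show ?thesis
    unfolding eq using padic_tendsto_poly[OF power_p_power_tendsto_1[OF q], of P] by metis
qed

text \<open>The sum telescopes to the difference quotient (F(p^N) - F(0)) / p^N. Writing F = a + X G
  makes it G(p^N), which tends to G(0) = F'(0).\<close>

lemma q_integral_sum_1_tendsto:
  fixes f :: "'a \<Rightarrow> 'a"
  assumes f: "\<And>x::nat. f (of_nat x) = poly F (of_nat (Suc x)) - poly F (of_nat x)"
  shows "q_integral_sum p 1 f \<longlonglongrightarrow> poly (pderiv F) 0"
proof -
  obtain a G where F: "F = pCons a G" by (cases F)
  have "q_integral_sum p 1 f N = poly G (of_nat (p ^ N))" for N
  proof -
    have "{0..p ^ N - 1} = {..<p ^ N}"
      using p_gt_1 by (auto simp: less_Suc_eq_le[symmetric])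
    then have "q_integral_sum p 1 f N
        = 1 / of_nat (p ^ N) * (poly F (of_nat (p ^ N)) - poly F (of_nat 0))"
      unfolding q_integral_sum_def q_bracket_def f
      by (simp add: sum_lessThan_telescope[where f = "\<lambda>x. poly F (of_nat x)", simplified])
    moreover have nz: "of_nat (p ^ N) \<noteq> (0 :: 'a)"
      using p_gt_1 by simp
    ultimately show ?thesis
      by (simp add: F nz del: of_nat_power of_nat_eq_0_iff)
  qed
  then have "q_integral_sum p 1 f = (\<lambda>N. poly G (of_nat (p ^ N)))" ..
  moreover have "poly (pderiv F) 0 = poly G 0"
    by (simp add: F pderiv_pCons)
  ultimately show ?thesis
    using padic_tendsto_poly[OF p_power_tendsto_0, of G] by metis
qed

end

section \<open>Polynomial and binomial identities\<close>

text \<open>Up to a constant, F is the Bernoulli polynomial of degree n + 1 divided by n + 1. The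
  binomial expansion of (y + 1)^(n+1) - y^(n+1) is solved for its term in y^n, the lower powers
  being handled by induction.\<close>

lemma exists_poly_difference_power:
  "\<exists>F :: 'a::field_char_0 poly. \<forall>y. poly F (y + 1) - poly F y = y ^ n"
proof (induction n rule: less_induct)
  case (less n)
  then obtain G :: "nat \<Rightarrow> 'a poly"
    where G: "\<And>k y. k < n \<Longrightarrow> poly (G k) (y + 1) - poly (G k) y = y ^ k"
    by metis
  define F where "F = smult (1 / of_nat (Suc n))
    (monom 1 (Suc n) - (\<Sum>k<n. smult (of_nat (Suc n choose k)) (G k)))"
  have "poly F (y + 1) - poly F y = y ^ n" for y
  proof -
    have "of_nat (Suc n) * (poly F (y + 1) - poly F y)
        = (y + 1) ^ Suc n - y ^ Suc n
          - (\<Sum>k<n. of_nat (Suc n choose k) * (poly (G k) (y + 1) - poly (G k) y))"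
      by (simp add: F_def poly_sum poly_monom sum_subtractf right_diff_distrib del: of_nat_Suc power_Suc)
    also have "(\<Sum>k<n. of_nat (Suc n choose k) * (poly (G k) (y + 1) - poly (G k) y))
        = (\<Sum>k<n. of_nat (Suc n choose k) * y ^ k)"
      by (rule sum.cong) (simp_all add: G)
    also have "(y + 1) ^ Suc n - y ^ Suc n - \<dots> = of_nat (Suc n) * y ^ n"
    proof -
      have "(y + 1) ^ Suc n = (\<Sum>k\<le>Suc n. of_nat (Suc n choose k) * y ^ k)"
        by (subst binomial_ring) simp
      also have "{..Suc n} = insert (Suc n) (insert n {..<n})"
        by auto
      finally show ?thesis by (simp del: power_Suc)
    qed
    finally show ?thesis
      by (simp del: of_nat_Suc)
  qed
  then show ?case by blast
qed

text \<open>The derivative of z (q + z)^n at z = -1. The proof splits \<open>Suc l\<close> as l + 1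
  and uses l (n choose l) = n (n - 1 choose l - 1).\<close>

lemma sum_binomial_alternating_Suc:
  fixes q :: "'a::comm_ring_1"
  assumes "n > 0"
  shows "(\<Sum>l\<le>n. of_nat (n choose l) * (- 1) ^ l * of_nat (Suc l) * q ^ (n - l))
    = (q - 1) ^ n - of_nat n * (q - 1) ^ (n - 1)"
proof -
  obtain m where m: "n = Suc m" using assms gr0_conv_Suc by auto
  have "(\<Sum>l\<le>n. of_nat (n choose l) * (- 1) ^ l * q ^ (n - l)) = (q - 1) ^ n"
    using binomial_ring[of "-1" q n] by simp
  moreover have "(\<Sum>l\<le>n. of_nat (n choose l) * (- 1) ^ l * of_nat l * q ^ (n - l))
      = - of_nat n * (q - 1) ^ (n - 1)"
  proof -
    have "(\<Sum>l\<le>n. of_nat (n choose l) * (- 1) ^ l * of_nat l * q ^ (n - l))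
        = (\<Sum>l\<le>m. of_nat (Suc l * (n choose Suc l)) * (- 1) ^ Suc l * q ^ (m - l))"
      unfolding m by (subst sum.atMost_Suc_shift)
        (simp add: mult_ac del: of_nat_Suc mult_Suc power_Suc binomial_Suc_Suc)
    also have "\<dots> = (\<Sum>l\<le>m. - of_nat n * (of_nat (m choose l) * (- 1) ^ l * q ^ (m - l)))"
    proof (rule sum.cong[OF refl])
      fix l
      have "(of_nat (Suc l * (n choose Suc l)) :: 'a) = of_nat n * of_nat (m choose l)"
        by (simp only: m mult.commute[of "Suc l"] flip: Suc_times_binomial_eq of_nat_mult)
      then show "of_nat (Suc l * (n choose Suc l)) * (- 1) ^ Suc l * q ^ (m - l)
          = - of_nat n * (of_nat (m choose l) * (- 1) ^ l * q ^ (m - l))"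
        by (simp only: power_Suc) (simp add: mult_ac)
    qed
    also have "\<dots> = - of_nat n * (q - 1) ^ m"
      using binomial_ring[of "-1" q m] by (simp add: sum_negf flip: sum_distrib_left)
    finally show ?thesis by (simp add: m)
  qed
  ultimately show ?thesis
    by (simp add: sum.distrib algebra_simps)
qed

text \<open>Subtracting summand by summand cancels every denominator 1 - q^(l+1). What remains is
  two alternating sums of the preceding kind, one at q and one at 1.\<close>

lemma q_moments_identity:
  fixes q :: "'a::field"
  assumes q0: "q \<noteq> 0" and unity: "\<And>l. q ^ Suc l \<noteq> 1" and "n > 1"
  shows "(\<Sum>l\<le>n. of_nat (n choose l) * (- 1) ^ l * q ^ (n - l) / (q - 1) ^ n
            * of_nat (Suc l) * ((1 - q) / (1 - q ^ Suc l)))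
    = q\<^sup>2 * (\<Sum>l\<le>n. of_nat (n choose l) * (- 1) ^ l / (1 - 1 / q) ^ n
            * of_nat (Suc l) * ((1 - 1 / q) / (1 - (1 / q) ^ Suc l))) + of_nat n + 1 - q"
    (is "?L = q\<^sup>2 * ?R + _ + _ - _")
proof -
  have q1: "q - 1 \<noteq> 0" using unity[of 0] by simp
  let ?b = "\<lambda>l. of_nat (n choose l) * (- 1) ^ l * of_nat (Suc l) :: 'a"
  let ?u = "(1 - q) / (q - 1) ^ n"
  have summand: "of_nat (n choose l) * (- 1) ^ l * q ^ (n - l) / (q - 1) ^ n
          * of_nat (Suc l) * ((1 - q) / (1 - q ^ Suc l))
      - q\<^sup>2 * (of_nat (n choose l) * (- 1) ^ l / (1 - 1 / q) ^ n
          * of_nat (Suc l) * ((1 - 1 / q) / (1 - (1 / q) ^ Suc l)))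
      = ?u * (?b l * q ^ (n - l) + q ^ Suc n * (?b l * 1 ^ (n - l)))" if "l \<le> n" for l
  proof -
    define s where "s = q ^ Suc l"
    have s: "s \<noteq> 1" "s \<noteq> 0" using unity[of l] q0 by (simp_all add: s_def)
    have "1 - 1 / q = (q - 1) / q" using q0 by (simp add: field_simps)
    then have a: "(1 - 1 / q) ^ n = (q - 1) ^ n / q ^ n"
      by (simp add: power_divide)
    have b: "(1 - 1 / q) / (1 - (1 / q) ^ Suc l) = (1 - q) * q ^ l / (1 - s)"
    proof -
      have "1 - (1 / q) ^ Suc l = (s - 1) / s"
        using s by (simp add: s_def power_divide field_simps)
      then have "(1 - 1 / q) / (1 - (1 / q) ^ Suc l) = ((q - 1) / q) / ((s - 1) / s)"
        using \<open>1 - 1 / q = (q - 1) / q\<close> by simp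
      also have "\<dots> = (1 - q) * q ^ l / (1 - s)"
        using s q0 by (simp add: divide_simps) (simp add: s_def algebra_simps)
      finally show ?thesis .
    qed
    \<comment> \<open>The cancellation: q^(n-l) s = q^(n+1), so the middle terms of the product drop
      out and q^(n+1) s is the subtracted term on the left.\<close>
    have c: "q ^ (n - l) - q\<^sup>2 * q ^ n * q ^ l = (q ^ (n - l) + q ^ Suc n) * (1 - s)"
    proof -
      have "q ^ (n - l) * s = q ^ Suc n"
        using that by (simp add: s_def flip: power_add)
      then show ?thesis
        by (simp add: algebra_simps power2_eq_square) (simp add: s_def)
    qed
    have factor: "x * y * a / d * k * (u / v) - c * (x * y / (d / e) * k * (u * g / v))
        = x * y * k * (u / d) * ((a - c * e * g) / v)" for x y a c d e g k u v :: 'a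
      by (simp add: diff_divide_distrib right_diff_distrib mult_ac)
    have "of_nat (n choose l) * (- 1) ^ l * q ^ (n - l) / (q - 1) ^ n
          * of_nat (Suc l) * ((1 - q) / (1 - s))
        - q\<^sup>2 * (of_nat (n choose l) * (- 1) ^ l / ((q - 1) ^ n / q ^ n)
          * of_nat (Suc l) * ((1 - q) * q ^ l / (1 - s)))
        = ?b l * ?u * ((q ^ (n - l) - q\<^sup>2 * q ^ n * q ^ l) / (1 - s))"
      by (rule factor)
    also have "\<dots> = ?b l * ?u * (q ^ (n - l) + q ^ Suc n)"
      unfolding c using s by simp
    also have "\<dots> = ?u * (?b l * q ^ (n - l) + q ^ Suc n * (?b l * 1 ^ (n - l)))"
      by (simp only: power_one mult_1_left mult_1_right distrib_left mult_ac)
    finally show ?thesis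
      unfolding a b s_def[symmetric] .
  qed
  have "?L - q\<^sup>2 * ?R
      = (\<Sum>l\<le>n. ?u * (?b l * q ^ (n - l) + q ^ Suc n * (?b l * 1 ^ (n - l))))"
    unfolding sum_distrib_left[of "q\<^sup>2"] sum_subtractf[symmetric]
    by (rule sum.cong[OF refl], rule summand) simp
  also have "\<dots> = ?u * ((\<Sum>l\<le>n. ?b l * q ^ (n - l)) + q ^ Suc n * (\<Sum>l\<le>n. ?b l * 1 ^ (n - l)))"
    by (simp only: sum.distrib flip: sum_distrib_left)
  \<comment> \<open>The sum at 1 equals 0^n - n 0^(n-1), which vanishes exactly because n >
    1.\<close>
  also have "\<dots> = ?u * ((q - 1) ^ n - of_nat n * (q - 1) ^ (n - 1))"
    using \<open>n > 1\<close> sum_binomial_alternating_Suc[of n q] sum_binomial_alternating_Suc[of n "1::'a"]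
    by (simp add: power_0_left)
  also have "\<dots> = of_nat n + 1 - q"
  proof -
    obtain m where "n = Suc m" using \<open>n > 1\<close> by (cases n) auto
    then show ?thesis
      using q1 by (simp add: field_simps)
  qed
  finally show ?thesis by (simp add: algebra_simps)
qed

section \<open>The reflection formula, separately for q = 1 and q \<noteq> 1\<close>

theorem theorem3:
  fixes p n :: nat
    and absp :: "'a::{alg_closed_field, field_char_0, complete_space} \<Rightarrow> real"
    and q :: 'a
  assumes "padic_complex_field p absp"
    and "absp (1 - q) < 1"
    and "\<forall>N. q_bracket q (of_nat (p ^ N)) \<noteq> 0"
    and "n > 1"
  shows "q_integrable p q (\<lambda>x. q_bracket (1 / q) (1 - x) ^ n)
       \<and> q_integrable p (1 / q) (\<lambda>x. q_bracket (1 / q) x ^ n)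
       \<and> q_integral p q (\<lambda>x. q_bracket (1 / q) (1 - x) ^ n)
         = q\<^sup>2 * q_integral p (1 / q) (\<lambda>x. q_bracket (1 / q) x ^ n) + of_nat n + 1 - q"
proof -
  interpret padic_complex_field p absp by fact
  let ?f = "\<lambda>x. q_bracket (1 / q) (1 - x) ^ n"
  let ?g = "\<lambda>x. q_bracket (1 / q) x ^ n"
  \<comment> \<open>Exhibiting the limits gives integrability and the values together.\<close>
  have "\<exists>A B. q_integral_sum p q ?f \<longlonglongrightarrow> A \<and> q_integral_sum p (1 / q) ?g \<longlonglongrightarrow> B
      \<and> A = q\<^sup>2 * B + of_nat n + 1 - q"
  proof (cases "q = 1")
    case True
    obtain F :: "'a poly" where F: "\<And>y. poly F (y + 1) - poly F y = y ^ n"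
      using exists_poly_difference_power[of n] by blast
    have "q_integral_sum p 1 (\<lambda>x. x ^ n) \<longlonglongrightarrow> poly (pderiv F) 0"
      by (rule q_integral_sum_1_tendsto) (simp add: add.commute[of 1] F)
    \<comment> \<open>The polynomial -F(2 - y) has forward difference F(2 - y) - F(1 - y) = (1 -
      y)^n, and its derivative at 0 is F'(2).\<close>
    moreover have "q_integral_sum p 1 (\<lambda>x. (1 - x) ^ n)
        \<longlonglongrightarrow> poly (pderiv (- (F \<circ>\<^sub>p [:2, - 1:]))) 0"
    proof (rule q_integral_sum_1_tendsto)
      fix x :: nat
      show "(1 - of_nat x) ^ n = poly (- (F \<circ>\<^sub>p [:2, - 1:])) (of_nat (Suc x))
          - poly (- (F \<circ>\<^sub>p [:2, - 1:])) (of_nat x)"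
        using F[of "1 - of_nat x"] by (simp add: poly_pcompose algebra_simps)
    qed
    moreover have "poly (pderiv (- (F \<circ>\<^sub>p [:2, - 1:]))) 0 = poly (pderiv F) 0 + of_nat n"
    proof -
      \<comment> \<open>Agreement at all points of an infinite field is a polynomial identity, which
        may be differentiated; its values at 0 and 1 then lead from F'(0) to F'(2).\<close>
      have "F \<circ>\<^sub>p [:1, 1:] - F = monom 1 n"
        by (simp add: poly_eq_poly_eq_iff[symmetric] fun_eq_iff poly_pcompose poly_monom
            add.commute[of 1] F)
      then have "pderiv (F \<circ>\<^sub>p [:1, 1:] - F) = monom (of_nat n) (n - 1)"
        by (simp add: pderiv_monom)
      then have "poly (pderiv (F \<circ>\<^sub>p [:1, 1:] - F)) y = of_nat n * y ^ (n - 1)" for y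
        by (simp add: poly_monom)
      then have "poly (pderiv F) (1 + y) - poly (pderiv F) y = of_nat n * y ^ (n - 1)" for y
        by (simp add: pderiv_diff pderiv_pcompose pderiv_pCons poly_pcompose)
      from this[of 0] this[of 1] show ?thesis
        using \<open>n > 1\<close> by (simp add: pderiv_pcompose pderiv_minus pderiv_pCons poly_pcompose
            power_0_left algebra_simps)
    qed
    ultimately show ?thesis
      unfolding True by (auto simp: q_bracket_def)
  next
    case False
    have abs1: "absp q = 1" by (rule absp_eq_1_if_near_1) fact
    then have q0: "q \<noteq> 0" using absp_0 by auto
    have q_unity: "q ^ (p ^ N) \<noteq> 1" for N
      using assms(3) q_bracket_of_nat[OF assms(2) False, of "p ^ N"] by (auto simp del: of_nat_power)
    \<comment> \<open>Since |q| = 1, the inverse 1/q lies in the same disc around 1.\<close>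
    have "absp (q * (1 - 1 / q)) < 1"
      using assms(2) q0 by (simp add: right_diff_distrib absp_minus_commute)
    then have r: "absp (1 - 1 / q) < 1"
      by (simp add: absp_mult abs1)
    have r1: "1 / q \<noteq> 1" using False by simp
    have r_unity: "(1 / q) ^ (p ^ N) \<noteq> 1" for N
      using q_unity[of N] by (simp add: power_divide)
    have expand: "(a - z) ^ n / d ^ n
        = (\<Sum>l\<le>n. of_nat (n choose l) * (- 1) ^ l * a ^ (n - l) / d ^ n * z ^ l)" for a z d :: 'a
    proof -
      have "(a - z) ^ n = (\<Sum>l\<le>n. of_nat (n choose l) * (- z) ^ l * a ^ (n - l))"
        using binomial_ring[of "- z" a n] by simp
      then show ?thesis
        by (simp add: sum_divide_distrib power_minus[of z] mult_ac)
    qed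
    have f: "?f (of_nat x)
        = (\<Sum>l\<le>n. of_nat (n choose l) * (- 1) ^ l * q ^ (n - l) / (q - 1) ^ n * (q ^ x) ^ l)"
      for x :: nat
    proof -
      \<comment> \<open>Reflection turns the base 1/q back into powers of q, matching the weight
        \<open>q ^ x\<close> of the left-hand integral.\<close>
      have "q_bracket (1 / q) (1 - of_nat x) = (q - q ^ x) / (q - 1)"
        using q0 False unfolding q_bracket_one_minus_of_nat[OF r r1]
        by (simp add: power_divide divide_simps)
      then show ?thesis by (simp add: power_divide expand)
    qed
    have g: "?g (of_nat x)
        = (\<Sum>l\<le>n. of_nat (n choose l) * (- 1) ^ l / (1 - 1 / q) ^ n * ((1 / q) ^ x) ^ l)"
      for x :: nat
      using expand[of 1 "(1 / q) ^ x" "1 - 1 / q"]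
      unfolding q_bracket_of_nat[OF r r1] power_divide[of "1 - (1 / q) ^ x"] by simp
    show ?thesis
      using q_integral_sum_tendsto[OF assms(2) q_unity f]
        q_integral_sum_tendsto[OF r r_unity g]
        q_moments_identity[OF q0 power_neq_1[OF assms(2) q_unity zero_less_Suc] \<open>n > 1\<close>]
      by blast
  qed
  then show ?thesis
    unfolding q_integrable_def q_integral_def by (auto simp: convergent_def limI)
qed

end
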